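(* (i) The value of any finite even-integer continued fraction (EICF) is an $\infty$-rational, and each $\infty$-rational has a unique finite EICF expansion. (ii) The value of an infinite EICF is either irrational or a $1$-rational, and (a) each irrational real number has a unique infinite EICF expansion; (b) each $1$-rational has exactly two infinite EICF expansions, each of which eventually alternates between $2$ and $-2$.
   Context: $\mathbb{R}_\infty=\mathbb{R}\cup\{\infty\}$ is the extended real line. An even-integer continued fraction (EICF) is a finite, infinite or empty sequence $[b_1,b_2,\dotsc]$ of even integers all of whose terms, except possibly $b_1$, are nonzero. The value of a finite EICF $[b_1,\dots,b_n]$ ($n\geq 1$) is the number $b_1+\cfrac{1}{b_2+\cfrac{1}{b_3+\cdots+\cfrac{1}{b_n}}}$; the empty EICF counts as a finite EICF and has value $\infty$. The convergents of an EICF $[b_1,b_2,\dotsc]$ are the values of $[b_1,\dots,b_n]$ for $n=1,2,\dotsc$. An infinite EICF converges, with value $x\in\mathbb{R}_\infty$, if its sequence of convergents converges in $\mathbb{R}_\infty$ to $x$ (every infinite EICF does converge). An EICF expansion of $x\in\mathbb{R}_\infty$ is an EICF with value $x$. Rationals are written in reduced form $a/b$ with $a,b$ coprime integers and $b>0$. The $\infty$-rationals are the reduced rationals $a/b$ whose numerator and denominator differ in parity, together with the point $\infty$. The $1$-rationals are the reduced rationals $a/b$ with both $a$ and $b$ odd. *)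

theory Defs
  imports "HOL-Analysis.Analysis"
begin

text \<open>The extended real line \<open>\<real> \<union> {\<infinity>}\<close> has a single point at infinity. It is the type
  \<^typ>\<open>real option\<close>, with \<^const>\<open>None\<close> playing the role of \<open>\<infinity>\<close>, topologised as the
  one-point compactification of the reals.\<close>

type_synonym ext_real_line = "real option"

abbreviation infinity_pt :: ext_real_line where
  "infinity_pt \<equiv> None"

abbreviation ext_real_topology :: "ext_real_line topology" where
  "ext_real_topology \<equiv> Alexandroff_compactification euclideanreal"

definition infinity_rational :: "ext_real_line \<Rightarrow> bool" where
  "infinity_rational x \<longleftrightarrow> x = infinity_pt \<or>
     (\<exists>a b :: int. b > 0 \<and> coprime a b \<and> even a \<noteq> even b \<and> x = Some (of_int a / of_int b))"

definition one_rational :: "ext_real_line \<Rightarrow> bool" where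
  "one_rational x \<longleftrightarrow>
     (\<exists>a b :: int. b > 0 \<and> coprime a b \<and> odd a \<and> odd b \<and> x = Some (of_int a / of_int b))"

definition irrational :: "ext_real_line \<Rightarrow> bool" where
  "irrational x \<longleftrightarrow> (\<exists>r. x = Some r \<and> r \<notin> \<rat>)"

text \<open>Finite EICFs (including the empty one) are lists; infinite ones are functions on
  \<^typ>\<open>nat\<close>, where \<open>s n\<close> is the term \<open>b\<^sub>n\<^sub>+\<^sub>1\<close>.\<close>

definition finite_EICF :: "int list \<Rightarrow> bool" where
  "finite_EICF bs \<longleftrightarrow> (\<forall>b \<in> set bs. even b) \<and> (\<forall>b \<in> set (tl bs). b \<noteq> 0)"

definition infinite_EICF :: "(nat \<Rightarrow> int) \<Rightarrow> bool" where
  "infinite_EICF s \<longleftrightarrow> (\<forall>n. even (s n)) \<and> (\<forall>n>0. s n \<noteq> 0)"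

text \<open>The value of a nonempty continued fraction, as a real number. For an EICF no denominator
  vanishes (see \<open>abs_cfrac_gt_1\<close>), so the convention \<open>1 / 0 = 0\<close> is never used.
  The value at \<open>[]\<close> is a dummy.\<close>

fun cfrac :: "int list \<Rightarrow> real" where
  "cfrac [] = 0"
| "cfrac [b] = of_int b"
| "cfrac (b # c # bs) = of_int b + 1 / cfrac (c # bs)"

lemma abs_cfrac_gt_1:
  assumes "bs \<noteq> []" "\<forall>b \<in> set bs. even b" "\<forall>b \<in> set bs. b \<noteq> 0"
  shows "\<bar>cfrac bs\<bar> > 1"
  using assms
proof (induction bs rule: cfrac.induct)
  case 1
  then show ?case by simp
next
  case (2 b)
  then have "\<bar>b\<bar> > 1" by (auto elim!: evenE)
  then show ?case by simp
next
  case (3 b c bs)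
  then have "\<bar>cfrac (c # bs)\<bar> > 1" by simp
  then have "\<bar>1 / cfrac (c # bs)\<bar> < 1" by simp
  moreover have "\<bar>b\<bar> \<ge> 2" using 3 by (auto elim!: evenE)
  then have "\<bar>real_of_int b\<bar> \<ge> 2" by linarith
  ultimately show ?case unfolding cfrac.simps by linarith
qed

definition finite_value :: "int list \<Rightarrow> ext_real_line" where
  "finite_value bs = (if bs = [] then infinity_pt else Some (cfrac bs))"

text \<open>\<open>EICF_convergent s n\<close> is the value of \<open>[b\<^sub>1, \<dots>, b\<^sub>n\<^sub>+\<^sub>1]\<close>; the empty truncation is not a
  convergent.\<close>

definition EICF_convergent :: "(nat \<Rightarrow> int) \<Rightarrow> nat \<Rightarrow> ext_real_line" where
  "EICF_convergent s n = finite_value (map s [0..<Suc n])"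

definition has_infinite_value :: "(nat \<Rightarrow> int) \<Rightarrow> ext_real_line \<Rightarrow> bool" where
  "has_infinite_value s x \<longleftrightarrow> limitin ext_real_topology (EICF_convergent s) x sequentially"

definition finite_EICF_expansion :: "int list \<Rightarrow> ext_real_line \<Rightarrow> bool" where
  "finite_EICF_expansion bs x \<longleftrightarrow> finite_EICF bs \<and> finite_value bs = x"

definition infinite_EICF_expansion :: "(nat \<Rightarrow> int) \<Rightarrow> ext_real_line \<Rightarrow> bool" where
  "infinite_EICF_expansion s x \<longleftrightarrow> infinite_EICF s \<and> has_infinite_value s x"

definition eventually_alternates_2 :: "(nat \<Rightarrow> int) \<Rightarrow> bool" where
  "eventually_alternates_2 s \<longleftrightarrow> (\<exists>N. \<forall>n\<ge>N. s n \<in> {2, -2} \<and> s (Suc n) = - s n)"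

end

theory Submission
  imports Defs
begin

text \<open>A sequence \<open>s\<close> has value \<open>x\<close> exactly when there are tails \<open>t\<^sub>0 = x, t\<^sub>1, t\<^sub>2, \<dots>\<close> with
  \<open>t\<^sub>k = s\<^sub>k + 1 / t\<^sub>k\<^sub>+\<^sub>1\<close> and \<open>\<bar>t\<^sub>k\<^sub>+\<^sub>1\<bar> \<ge> 1\<close>: the denominators of the convergents strictly increase in absolute
  value, so that the \<open>n\<close>-th convergent is within \<open>1 / n\<close> of \<open>x\<close>. The first term is therefore an even
  integer within distance 1 of \<open>x\<close>, and it is unique unless \<open>x\<close> is an odd integer. Passing from a
  rational \<open>a / b\<close> to the next tail \<open>b / (a - s\<^sub>0 b)\<close> preserves the parity of \<open>a + b\<close> and does not
  increase \<open>\<bar>b\<bar>\<close>. When \<open>a + b\<close> is odd, \<open>\<bar>b\<bar>\<close> strictly decreases and the expansion terminates. When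
  \<open>a\<close> and \<open>b\<close> are odd, the descent ends at an odd integer \<open>m\<close>, where the two choices of first term
  \<open>m \<plusminus> 1\<close> lead to the tail \<open>\<mp>1\<close>, whose expansion is forced to alternate between 2 and -2.\<close>

section \<open>Continuants and the error of a convergent\<close>

text \<open>For an infinite EICF, convergence in \<open>ext_real_topology\<close> reduces to this
  real limit, because infinity never occurs as its value; see
  \<open>has_infinite_value_iff\<close>.\<close>

definition real_value :: "(nat \<Rightarrow> int) \<Rightarrow> real \<Rightarrow> bool" where
  "real_value s x \<longleftrightarrow> (\<lambda>n. cfrac (map s [0..<Suc n])) \<longlonglongrightarrow> x"

text \<open>With \<open>cf_den\<close>, the usual continuants, shifted: index 0 gives 0/1, index 1
  gives 1/0 for the empty fraction, and index \<open>n + 2\<close> gives the convergent ending in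
  \<open>s n\<close>.\<close>

fun cf_num :: "(nat \<Rightarrow> int) \<Rightarrow> nat \<Rightarrow> int" where
  "cf_num s 0 = 0"
| "cf_num s (Suc 0) = 1"
| "cf_num s (Suc (Suc n)) = s n * cf_num s (Suc n) + cf_num s n"

fun cf_den :: "(nat \<Rightarrow> int) \<Rightarrow> nat \<Rightarrow> int" where
  "cf_den s 0 = 1"
| "cf_den s (Suc 0) = 0"
| "cf_den s (Suc (Suc n)) = s n * cf_den s (Suc n) + cf_den s n"

lemma even_nonzero_abs_ge_2: "even b \<Longrightarrow> b \<noteq> 0 \<Longrightarrow> \<bar>b\<bar> \<ge> (2::int)"
  by presburger

text \<open>Each step of the recurrences multiplies the determinant by -1; absolute values avoid
  tracking the sign.\<close>

lemma cf_det: "\<bar>cf_num s (Suc n) * cf_den s n - cf_num s n * cf_den s (Suc n)\<bar> = 1"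
proof (induction n)
  case (Suc n)
  have "cf_num s (Suc (Suc n)) * cf_den s (Suc n) - cf_num s (Suc n) * cf_den s (Suc (Suc n))
      = - (cf_num s (Suc n) * cf_den s n - cf_num s n * cf_den s (Suc n))"
    by (simp add: algebra_simps)
  with Suc show ?case by linarith
qed simp

text \<open>Terms after the first have absolute value at least 2, so the triangle inequality pushes
  each denominator beyond the last. Growth starts at index 1, since the denominators at indices 0
  and 1 are 1 and 0.\<close>

lemma cf_den_abs_less:
  assumes "infinite_EICF s"
  shows "\<bar>cf_den s (Suc n)\<bar> < \<bar>cf_den s (Suc (Suc n))\<bar>"
proof (induction n)
  case (Suc n)
  have "\<bar>s (Suc n)\<bar> \<ge> 2"
    using assms even_nonzero_abs_ge_2 unfolding infinite_EICF_def by simp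
  then have "2 * \<bar>cf_den s (Suc (Suc n))\<bar> \<le> \<bar>s (Suc n) * cf_den s (Suc (Suc n))\<bar>"
    unfolding abs_mult by (rule mult_right_mono) simp
  moreover have "cf_den s (Suc (Suc (Suc n)))
      = s (Suc n) * cf_den s (Suc (Suc n)) + cf_den s (Suc n)" by simp
  ultimately show ?case using Suc by linarith
qed simp

lemma cf_den_abs_ge:
  assumes "infinite_EICF s"
  shows "\<bar>cf_den s (Suc n)\<bar> \<ge> int n"
proof (induction n)
  case (Suc n)
  then show ?case using cf_den_abs_less[OF assms, of n] by linarith
qed simp

text \<open>Composes the Moebius maps \<open>y \<mapsto> s k + 1 / y\<close>, cross-multiplied so
  that the composed denominator need not be known to be nonzero. The sequence \<open>t\<close> is
  later either the tails of an infinite fraction or the values of truncated segments.\<close>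

lemma cf_chain:
  fixes t :: "nat \<Rightarrow> real"
  assumes "\<And>k. k < m \<Longrightarrow> t k = s k + 1 / t (Suc k) \<and> t (Suc k) \<noteq> 0"
  shows "t 0 * (cf_den s (Suc m) * t m + cf_den s m) = cf_num s (Suc m) * t m + cf_num s m"
  using assms
proof (induction m)
  case (Suc m)
  have IH: "t 0 * (cf_den s (Suc m) * t m + cf_den s m) = cf_num s (Suc m) * t m + cf_num s m"
    by (rule Suc.IH) (rule Suc.prems, simp)
  have nz: "t (Suc m) \<noteq> 0" and tm: "t m = s m + 1 / t (Suc m)" using Suc.prems by auto
  have e: "t m * t (Suc m) = s m * t (Suc m) + 1" using nz unfolding tm by (simp add: field_simps)
  have "t 0 * (cf_den s (Suc m) * (t m * t (Suc m)) + cf_den s m * t (Suc m))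
      = (t 0 * (cf_den s (Suc m) * t m + cf_den s m)) * t (Suc m)"
    by (simp add: algebra_simps)
  also have "\<dots> = cf_num s (Suc m) * (t m * t (Suc m)) + cf_num s m * t (Suc m)"
    unfolding IH by (simp add: algebra_simps)
  finally show ?case unfolding e by (simp add: algebra_simps)
qed simp

lemma cfrac_map_Cons:
  assumes "k < n"
  shows "cfrac (map s [k..<Suc n]) = s k + 1 / cfrac (map s [Suc k..<Suc n])"
proof -
  have "[k..<Suc n] = k # Suc k # [Suc (Suc k)..<Suc n]" "[Suc k..<Suc n] = Suc k # [Suc (Suc k)..<Suc n]"
    using assms by (simp_all add: upt_conv_Cons)
  then show ?thesis by simp
qed

lemma abs_cfrac_map_gt_1:
  assumes "infinite_EICF s" "0 < k" "k \<le> n"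
  shows "\<bar>cfrac (map s [k..<Suc n])\<bar> > 1"
  using assms by (intro abs_cfrac_gt_1) (simp_all add: infinite_EICF_def del: upt_Suc)

lemma cfrac_eq_num_den:
  assumes "infinite_EICF s"
  shows "cfrac (map s [0..<Suc n]) * cf_den s (Suc (Suc n)) = cf_num s (Suc (Suc n))"
proof -
  have "cfrac (map s [k..<Suc n]) = s k + 1 / cfrac (map s [Suc k..<Suc n]) \<and>
      cfrac (map s [Suc k..<Suc n]) \<noteq> 0" if "k < n" for k
    using cfrac_map_Cons[OF that] abs_cfrac_map_gt_1[OF assms, of "Suc k" n] that by force
  \<comment> \<open>The tail at index \<open>n\<close> is just \<open>s n\<close>, so the
    recurrences turn both sides into continuants of index \<open>n + 2\<close>.\<close>
  from cf_chain[of n "\<lambda>k. cfrac (map s [k..<Suc n])" s, OF this]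
  show ?thesis by (simp add: algebra_simps)
qed

text \<open>The Moebius map sending the tail \<open>t (Suc n)\<close> to \<open>t 0\<close> has determinant \<open>\<plusminus>1\<close>, and its
  denominator has absolute value at least 1 because \<^term>\<open>\<bar>t (Suc n)\<bar> \<ge> 1\<close>.\<close>
lemma cfrac_chain_dist:
  fixes t :: "nat \<Rightarrow> real"
  assumes s: "infinite_EICF s"
    and t: "\<And>k. k \<le> n \<Longrightarrow> t k = s k + 1 / t (Suc k) \<and> \<bar>t (Suc k)\<bar> \<ge> 1"
  shows "\<bar>t 0 - cfrac (map s [0..<Suc n])\<bar> \<le> 1 / Suc n"
proof -
  define q q' p p' x y c where "q = real_of_int (cf_den s (Suc (Suc n)))"
    and "q' = real_of_int (cf_den s (Suc n))"
    and "p = real_of_int (cf_num s (Suc (Suc n)))" and "p' = real_of_int (cf_num s (Suc n))"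
    and "x = t 0" and "y = t (Suc n)" and "c = cfrac (map s [0..<Suc n])"
  have "t k = s k + 1 / t (Suc k) \<and> t (Suc k) \<noteq> 0" if "k < Suc n" for k
    using t[of k] that by force
  from cf_chain[of "Suc n" t s, OF this]
  have "x * (q * y + q') = p * y + p'"
    unfolding q_def q'_def p_def p'_def x_def y_def .
  \<comment> \<open>Expanding and substituting the Moebius relation leaves only the
    determinant.\<close>
  then have "(x * q - p) * (q * y + q') = - (p * q' - p' * q)"
    by algebra
  moreover have "\<bar>p * q' - p' * q\<bar> = 1"
    using cf_det[of s "Suc n"] unfolding q_def q'_def p_def p'_def
    by (metis of_int_1 of_int_abs of_int_diff of_int_mult)
  ultimately have 1: "\<bar>x * q - p\<bar> * \<bar>q * y + q'\<bar> = 1"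
    by (simp add: abs_mult[symmetric])
  have y: "\<bar>y\<bar> \<ge> 1" using t unfolding y_def by simp
  have "\<bar>cf_den s (Suc n)\<bar> + 1 \<le> \<bar>cf_den s (Suc (Suc n))\<bar>"
    using cf_den_abs_less[OF s, of n] by linarith
  then have "real_of_int (\<bar>cf_den s (Suc n)\<bar> + 1) \<le> real_of_int \<bar>cf_den s (Suc (Suc n))\<bar>"
    by (simp only: of_int_le_iff)
  then have q: "\<bar>q'\<bar> + 1 \<le> \<bar>q\<bar>" unfolding q_def q'_def by simp
  moreover have "\<bar>q\<bar> * 1 \<le> \<bar>q\<bar> * \<bar>y\<bar>" using y by (intro mult_left_mono) auto
  then have "\<bar>q\<bar> \<le> \<bar>q * y\<bar>" by (simp add: abs_mult)
  ultimately have 2: "\<bar>q * y + q'\<bar> \<ge> 1" by linarith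
  have "\<bar>x * q - p\<bar> * 1 \<le> \<bar>x * q - p\<bar> * \<bar>q * y + q'\<bar>"
    using 2 by (intro mult_left_mono) auto
  then have 3: "\<bar>x * q - p\<bar> \<le> 1" using 1 by simp
  have "p = c * q" using cfrac_eq_num_den[OF s, of n] unfolding p_def c_def q_def by simp
  then have "\<bar>x * q - p\<bar> = \<bar>x - c\<bar> * \<bar>q\<bar>" by (simp add: abs_mult[symmetric] algebra_simps)
  with 3 have 4: "\<bar>x - c\<bar> * \<bar>q\<bar> \<le> 1" by simp
  have "int (Suc n) \<le> \<bar>cf_den s (Suc (Suc n))\<bar>" using cf_den_abs_ge[OF s, of "Suc n"] .
  then have "real_of_int (int (Suc n)) \<le> real_of_int \<bar>cf_den s (Suc (Suc n))\<bar>"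
    by (simp only: of_int_le_iff)
  then have "real (Suc n) \<le> \<bar>q\<bar>" unfolding q_def by simp
  then have "\<bar>x - c\<bar> * Suc n \<le> \<bar>x - c\<bar> * \<bar>q\<bar>" by (intro mult_left_mono) auto
  with 4 have "\<bar>x - c\<bar> * Suc n \<le> 1" by linarith
  then show ?thesis unfolding x_def c_def by (simp add: field_simps)
qed

section \<open>Convergence and tails of infinite EICFs\<close>

text \<open>The final segments of a longer truncation serve as tails in
  \<open>cfrac_chain_dist\<close>, so all later convergents lie within \<open>1 / Suc n\<close> of
  the one with index \<open>n\<close>.\<close>

lemma infinite_EICF_real_value:
  assumes "infinite_EICF s"
  obtains x where "real_value s x"
proof -
  let ?c = "\<lambda>n. cfrac (map s [0..<Suc n])"
  have d: "\<bar>?c m - ?c n\<bar> \<le> 1 / Suc n" if "n < m" for m n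
  proof (rule cfrac_chain_dist[OF assms, where t = "\<lambda>k. cfrac (map s [k..<Suc m])"])
    fix k assume "k \<le> n"
    then show "cfrac (map s [k..<Suc m]) = s k + 1 / cfrac (map s [Suc k..<Suc m]) \<and>
        1 \<le> \<bar>cfrac (map s [Suc k..<Suc m])\<bar>"
      using that cfrac_map_Cons[of k m s] abs_cfrac_map_gt_1[OF assms, of "Suc k" m] by simp
  qed
  have "Cauchy ?c"
  proof (rule CauchyI')
    fix e :: real assume "e > 0"
    then obtain M where M: "1 / Suc M < e" using nat_approx_posE by blast
    have "dist (?c m) (?c n) < e" if "M \<le> m" "m < n" for m n
    proof -
      have "1 / real (Suc m) \<le> 1 / Suc M" using that by (intro divide_left_mono) auto
      then show ?thesis using d[OF that(2)] M unfolding dist_real_def by linarith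
    qed
    then show "\<exists>M. \<forall>m\<ge>M. \<forall>n>m. dist (?c m) (?c n) < e" by blast
  qed
  then show ?thesis using that unfolding real_value_def
    by (auto simp: Cauchy_convergent_iff convergent_def)
qed

lemma real_value_unique: "real_value s x \<Longrightarrow> real_value s y \<Longrightarrow> x = y"
  unfolding real_value_def by (rule LIMSEQ_unique)

text \<open>The tool for constructing expansions: exhibiting tails suffices. The non-strict bound
  admits the tails 1 and -1 of the alternating fractions.\<close>

lemma real_value_of_tails:
  fixes t :: "nat \<Rightarrow> real"
  assumes "infinite_EICF s" and "\<And>k. t k = s k + 1 / t (Suc k)" and "\<And>k. \<bar>t (Suc k)\<bar> \<ge> 1"
  shows "real_value s (t 0)"
proof -
  have "\<bar>t 0 - cfrac (map s [0..<Suc n])\<bar> \<le> 1 / Suc n" for n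
    by (intro cfrac_chain_dist[OF assms(1)] conjI assms(2,3))
  then have "(\<lambda>n. cfrac (map s [0..<Suc n]) - t 0) \<longlonglongrightarrow> 0"
    by (intro Lim_null_comparison[OF _ lim_1_over_n[THEN LIMSEQ_Suc]] always_eventually)
      (simp add: abs_minus_commute)
  then show ?thesis unfolding real_value_def by (simp add: LIM_zero_iff)
qed

text \<open>\<open>Some\<close> is continuous into the compactification, so the real limit is also a
  limit there; the Hausdorff property makes it the only one, which excludes infinity.\<close>

lemma has_infinite_value_iff:
  assumes "infinite_EICF s"
  shows "has_infinite_value s x \<longleftrightarrow> (\<exists>r. x = Some r \<and> real_value s r)"
proof -
  have conv: "EICF_convergent s = Some \<circ> (\<lambda>n. cfrac (map s [0..<Suc n]))"
    unfolding EICF_convergent_def finite_value_def by (auto simp: fun_eq_iff)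
  have lim: "has_infinite_value s (Some r)" if "real_value s r" for r
    using that continuous_map_limit[OF continuous_map_Some[of euclideanreal]]
    unfolding has_infinite_value_def conv real_value_def by simp
  have "Hausdorff_space ext_real_topology"
    by (simp add: Hausdorff_space_Alexandroff_compactification
        locally_compact_space_euclidean)
  then have "y = z" if "has_infinite_value s y" "has_infinite_value s z" for y z
    using that unfolding has_infinite_value_def
    by (metis limitin_Hausdorff_unique trivial_limit_sequentially)
  with lim show ?thesis using infinite_EICF_real_value[OF assms] by metis
qed

lemma infinite_EICF_expansion_Some_iff:
  "infinite_EICF_expansion s (Some x) \<longleftrightarrow> infinite_EICF s \<and> real_value s x"
  unfolding infinite_EICF_expansion_def by (simp add: has_infinite_value_iff cong: conj_cong)

lemma infinite_EICF_shift: "infinite_EICF s \<Longrightarrow> infinite_EICF (\<lambda>n. s (n + k))"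
  unfolding infinite_EICF_def by simp

lemma cfrac_map_Suc:
  "cfrac (map s [0..<Suc (Suc n)]) = s 0 + 1 / cfrac (map (\<lambda>n. s (Suc n)) [0..<Suc n])"
proof -
  have "map s [Suc 0..<Suc (Suc n)] = map (\<lambda>n. s (Suc n)) [0..<Suc n]"
    by (simp add: map_Suc_upt[symmetric] del: upt_Suc)
  then show ?thesis using cfrac_map_Cons[of 0 "Suc n" s] by (simp del: upt_Suc)
qed

lemma real_value_Suc:
  assumes "real_value (\<lambda>n. s (Suc n)) t" "t \<noteq> 0"
  shows "real_value s (s 0 + 1 / t)"
proof -
  have "(\<lambda>n. s 0 + 1 / cfrac (map (\<lambda>n. s (Suc n)) [0..<Suc n])) \<longlonglongrightarrow> s 0 + 1 / t"
    using assms unfolding real_value_def by (intro tendsto_intros)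
  then show ?thesis unfolding real_value_def cfrac_map_Suc[symmetric] by (rule LIMSEQ_imp_Suc)
qed

text \<open>Convergents of the shifted sequence exceed 1 strictly in absolute value, but their limit
  may reach 1. This boundary case is the source of double expansions.\<close>

lemma real_value_tail:
  assumes "infinite_EICF s" "real_value s x"
  obtains t where "real_value (\<lambda>n. s (Suc n)) t" "\<bar>t\<bar> \<ge> 1" "x = s 0 + 1 / t"
proof -
  obtain t where t: "real_value (\<lambda>n. s (Suc n)) t"
    using infinite_EICF_real_value infinite_EICF_shift[OF assms(1), of 1] by auto
  have "\<bar>cfrac (map (\<lambda>n. s (Suc n)) [0..<Suc n])\<bar> > 1" for n
    using assms(1) by (intro abs_cfrac_gt_1) (auto simp: infinite_EICF_def)
  then have "\<bar>t\<bar> \<ge> 1" using t unfolding real_value_def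
    by (intro LIMSEQ_le_const[OF tendsto_rabs]) (auto intro: less_imp_le)
  moreover from this have "x = s 0 + 1 / t"
    by (intro real_value_unique[OF assms(2) real_value_Suc[OF t]]) auto
  ultimately show ?thesis using t that by blast
qed

lemma real_value_tails:
  assumes "infinite_EICF s" "real_value s x"
  obtains t where "t 0 = x" "\<And>k. t k = s k + 1 / t (Suc k)" "\<And>k. \<bar>t (Suc k)\<bar> \<ge> 1"
proof -
  have "\<exists>y. real_value (\<lambda>n. s (n + k)) y" for k
    using infinite_EICF_real_value[OF infinite_EICF_shift[OF assms(1)]] by blast
  then obtain t where t: "\<And>k. real_value (\<lambda>n. s (n + k)) (t k)" by metis
  have "t k = s k + 1 / t (Suc k) \<and> \<bar>t (Suc k)\<bar> \<ge> 1" for k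
  proof -
    obtain y where y: "real_value (\<lambda>n. s (Suc n + k)) y" "\<bar>y\<bar> \<ge> 1" "t k = s (0 + k) + 1 / y"
      by (rule real_value_tail[OF infinite_EICF_shift[OF assms(1)] t[of k]])
    have "y = t (Suc k)" using real_value_unique y(1) t[of "Suc k"] by simp
    then show ?thesis using y by simp
  qed
  moreover have "t 0 = x" using real_value_unique[OF t[of 0]] assms(2) by simp
  ultimately show ?thesis using that by blast
qed

section \<open>Even integers near a real number\<close>

text \<open>Distinct even integers are at least 2 apart. One bound is strict because an odd integer
  is at distance exactly 1 from both even neighbours.\<close>

lemma even_ints_eq:
  fixes x :: real and b c :: int
  assumes "even b" "even c" "\<bar>x - b\<bar> < 1" "\<bar>x - c\<bar> \<le> 1"
  shows "b = c"
proof -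
  have "\<bar>real_of_int (b - c)\<bar> < 2" using assms(3,4) by simp
  then have "\<bar>b - c\<bar> < 2" by linarith
  moreover have "even (b - c)" using assms by simp
  ultimately show ?thesis using even_nonzero_abs_ge_2[of "b - c"] by fastforce
qed

lemma nearest_even_int:
  fixes x :: real
  obtains b :: int where "even b" "\<bar>x - of_int b\<bar> \<le> 1"
proof
  \<comment> \<open>Rounding \<open>x / 2\<close> has error at most 1/2, which doubling turns into
    1.\<close>
  show "even (2 * round (x / 2))" by simp
  show "\<bar>x - of_int (2 * round (x / 2))\<bar> \<le> 1"
    using of_int_round_abs_le[of "x / 2"] by (simp add: abs_if split: if_splits)
qed

lemma abs_inverse_le_1: "\<bar>t::real\<bar> \<ge> 1 \<Longrightarrow> \<bar>1 / t\<bar> \<le> 1"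
  by (simp add: divide_le_eq_1)

section \<open>Rational values of infinite EICFs\<close>

text \<open>Infinite descent: the next tail is \<open>b / r\<close> with
  \<open>\<bar>r\<bar> \<le> \<bar>b\<bar>\<close>, and equality is excluded because
  \<open>b + r\<close> is odd again.\<close>

lemma no_tails_odd_sum:
  fixes t :: "nat \<Rightarrow> real"
  assumes "\<And>k. even (s k)" "\<And>k. t k = s k + 1 / t (Suc k)" "\<And>k. \<bar>t (Suc k)\<bar> \<ge> 1"
    and "t 0 = of_int a / of_int b" "b \<noteq> 0" "odd (a + b)"
  shows False
  using assms
proof (induction "nat \<bar>b\<bar>" arbitrary: a b s t rule: less_induct)
  case less
  define r where "r = a - s 0 * b"
  have eq: "1 / t 1 = r / b"
    using less.prems(2)[of 0] less.prems(4,5) unfolding r_def by (simp add: field_simps)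
  have t1: "\<bar>t 1\<bar> \<ge> 1" using less.prems(3)[of 0] by simp
  \<comment> \<open>A zero remainder would put the next tail at infinity, where only a finite
    expansion ends.\<close>
  have r0: "r \<noteq> 0" using eq t1 by auto
  have "\<bar>real_of_int r / of_int b\<bar> \<le> 1" unfolding eq[symmetric] by (rule abs_inverse_le_1[OF t1])
  then have "\<bar>r\<bar> \<le> \<bar>b\<bar>" using less.prems(5) by (simp add: field_simps abs_divide flip: of_int_abs)
  moreover have odd: "odd (b + r)" unfolding r_def using less.prems(1)[of 0] less.prems(6) by simp
  then have "\<bar>r\<bar> \<noteq> \<bar>b\<bar>" by (auto simp: abs_eq_iff)
  ultimately have lt: "nat \<bar>r\<bar> < nat \<bar>b\<bar>" by linarith
  have "t 1 = b / r" using eq r0 less.prems(5) t1 by (auto simp: field_simps)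
  then have t1': "t (Suc 0) = b / r" by simp
  show False
    by (rule less.hyps[of r "\<lambda>k. s (Suc k)" "\<lambda>k. t (Suc k)" b])
      (fact lt less.prems(1-3) t1' r0 odd)+
qed

lemma infinite_value_irrational_or_one_rational:
  assumes "infinite_EICF s" "real_value s x"
  shows "irrational (Some x) \<or> one_rational (Some x)"
proof (cases "x \<in> \<rat>")
  case True
  then obtain a b :: int where ab: "b > 0" "coprime a b" "x = of_int a / of_int b"
    by (rule Rats_cases')
  obtain t where t: "t 0 = x" "\<And>k. t k = s k + 1 / t (Suc k)" "\<And>k. \<bar>t (Suc k)\<bar> \<ge> 1"
    using real_value_tails[OF assms] by blast
  have "even (a + b)"
    using no_tails_odd_sum[of s t a b, OF _ t(2,3)] t(1) ab assms(1)
    unfolding infinite_EICF_def by auto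
  moreover have "odd a \<or> odd b" using ab(2) by (meson coprime_common_divisor odd_one)
  ultimately show ?thesis using ab unfolding one_rational_def by auto
qed (simp add: irrational_def)

section \<open>Expansions of irrational numbers\<close>

text \<open>Irrational tails are never 1 or -1, so the distance to the first term is strictly below
  1 and \<open>even_ints_eq\<close> forces equal terms, hence equal next tails.\<close>

lemma irrational_infinite_EICF_unique:
  assumes "infinite_EICF s" "real_value s x" "infinite_EICF s'" "real_value s' x" "x \<notin> \<rat>"
  shows "s = s'"
proof -
  obtain t where t: "t 0 = x" "\<And>k. t k = s k + 1 / t (Suc k)" "\<And>k. \<bar>t (Suc k)\<bar> \<ge> 1"
    using real_value_tails[OF assms(1,2)] by blast
  obtain t' where t': "t' 0 = x" "\<And>k. t' k = s' k + 1 / t' (Suc k)" "\<And>k. \<bar>t' (Suc k)\<bar> \<ge> 1"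
    using real_value_tails[OF assms(3,4)] by blast
  have step: "s k = s' k \<and> t (Suc k) = t' (Suc k) \<and> t (Suc k) \<notin> \<rat>"
    if "t k = t' k" "t k \<notin> \<rat>" for k
  proof -
    have irr: "t (Suc k) \<notin> \<rat>" using that(2) t(2)[of k] by auto
    then have "t (Suc k) \<noteq> 1" "t (Suc k) \<noteq> -1" by auto
    then have "\<bar>t (Suc k)\<bar> > 1" using t(3)[of k] by linarith
    then have "\<bar>1 / t (Suc k)\<bar> < 1" by simp
    then have "\<bar>t k - s k\<bar> < 1" using t(2)[of k] by simp
    moreover have "\<bar>t k - s' k\<bar> \<le> 1" using t'(2)[of k] that(1) abs_inverse_le_1[OF t'(3)[of k]] by simp
    ultimately have "s k = s' k" using assms(1,3) even_ints_eq unfolding infinite_EICF_def by blast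
    then show ?thesis using irr t(2)[of k] t'(2)[of k] that(1) by simp
  qed
  have "t k = t' k \<and> t k \<notin> \<rat>" for k
  proof (induction k)
    case (Suc k)
    then show ?case using step[of k] by metis
  qed (use t(1) t'(1) assms(5) in auto)
  then show ?thesis using step by blast
qed

lemma irrational_infinite_EICF_exists:
  fixes x :: real
  assumes "x \<notin> \<rat>"
  obtains s where "infinite_EICF s" "real_value s x"
proof -
  have "\<exists>b::int. even b \<and> \<bar>y - of_int b\<bar> \<le> 1" for y :: real
    using nearest_even_int[of y] by blast
  then obtain e :: "real \<Rightarrow> int" where e: "\<And>y. even (e y)" "\<And>y. \<bar>y - e y\<bar> \<le> 1"
    by metis
  \<comment> \<open>Nearest-even-integer algorithm: subtract the chosen even integer and invert,
    repeatedly.\<close>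
  define t where "t k = ((\<lambda>y. 1 / (y - e y)) ^^ k) x" for k
  define s where "s k = e (t k)" for k
  have t_Suc: "t (Suc k) = 1 / (t k - s k)" for k unfolding t_def s_def by simp
  have irr: "t k \<notin> \<rat>" for k
  proof (induction k)
    case 0
    then show ?case using assms by (simp add: t_def)
  next
    case (Suc k)
    show ?case
    proof
      assume "t (Suc k) \<in> \<rat>"
      then have "of_int (s k) + 1 / t (Suc k) \<in> \<rat>" by simp
      then show False using Suc unfolding t_Suc by simp
    qed
  qed
  have eq: "t k = s k + 1 / t (Suc k)" for k unfolding t_Suc by simp
  have nz: "t k \<noteq> s k" for k using irr[of k] by auto
  have ge: "\<bar>t (Suc k)\<bar> \<ge> 1" for k
    using e(2)[of "t k"] nz[of k] unfolding t_Suc s_def by (simp add: field_simps)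
  \<comment> \<open>Choosing 0 would need a tail of absolute value at most 1, hence exactly 1, which
    is rational.\<close>
  have "s (Suc k) \<noteq> 0" for k
  proof
    assume "s (Suc k) = 0"
    then have "\<bar>t (Suc k)\<bar> \<le> 1" using e(2)[of "t (Suc k)"] unfolding s_def by simp
    then have "t (Suc k) = 1 \<or> t (Suc k) = -1" using ge[of k] by linarith
    then show False using irr[of "Suc k"] by auto
  qed
  then have "infinite_EICF s" unfolding infinite_EICF_def
    using e(1) gr0_conv_Suc by (auto simp: s_def)
  moreover from this have "real_value s x" using real_value_of_tails[of s t, OF _ eq ge] by (simp add: t_def)
  ultimately show ?thesis using that by blast
qed

section \<open>Expansions of 1-rationals\<close>

definition alternating_2 :: "int \<Rightarrow> nat \<Rightarrow> int" where
  "alternating_2 e n = 2 * e * (-1) ^ n"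

lemma infinite_EICF_alternating_2: "e \<in> {1, -1} \<Longrightarrow> infinite_EICF (alternating_2 e)"
  unfolding infinite_EICF_def alternating_2_def by auto

lemma eventually_alternates_alternating_2:
  assumes "e \<in> {1, -1}"
  shows "eventually_alternates_2 (alternating_2 e)"
proof -
  have "alternating_2 e n \<in> {2, -2}" for n
    using assms by (cases "even n") (auto simp: alternating_2_def)
  then show ?thesis unfolding eventually_alternates_2_def by (auto simp: alternating_2_def)
qed

text \<open>The tails are \<open>e\<close>, \<open>-e\<close>, \<open>e\<close>, and so on, since
  \<open>u = 2 * u + 1 / (-u)\<close> for a sign \<open>u\<close>.\<close>

lemma real_value_alternating_2:
  assumes "e \<in> {1, -1}"
  shows "real_value (alternating_2 e) e"
proof -
  have [simp]: "\<bar>real_of_int e\<bar> = 1" "1 / real_of_int e = of_int e" using assms by auto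
  have "1 / (real_of_int e * (-1) ^ Suc k) = - (e * (-1) ^ k)" for k
    by (cases "even k") auto
  then have "real_value (alternating_2 e) (e * (-1) ^ 0)"
    by (intro real_value_of_tails[OF infinite_EICF_alternating_2[OF assms], of "\<lambda>k. e * (-1) ^ k"])
      (auto simp: alternating_2_def abs_mult)
  then show ?thesis by simp
qed

text \<open>A tail \<open>u\<close> equal to 1 or -1 is within 1 of an even term of absolute value
  at least 2, so that term is \<open>2 * u\<close> and the next tail is \<open>-u\<close>. The
  condition on \<open>s 0\<close> rules out the other start \<open>e = 0 + 1 / e\<close>.\<close>

lemma eq_alternating_2:
  assumes "infinite_EICF s" "s 0 \<noteq> 0" "e \<in> {1, -1}" "real_value s (of_int e)"
  shows "s = alternating_2 e"
proof -
  obtain t where t: "t 0 = of_int e" "\<And>k. t k = s k + 1 / t (Suc k)" "\<And>k. \<bar>t (Suc k)\<bar> \<ge> 1"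
    by (rule real_value_tails[OF assms(1,4)]) (rule that)
  have s2: "\<bar>s k\<bar> \<ge> 2" for k using assms(1,2) unfolding infinite_EICF_def
    by (cases k) (auto intro!: even_nonzero_abs_ge_2)
  have step: "s k = 2 * u \<and> t (Suc k) = - u" if "t k = of_int u" "u \<in> {1, -1}" for k and u :: int
  proof -
    have "\<bar>real_of_int u - s k\<bar> \<le> 1" using t(2)[of k] that abs_inverse_le_1[OF t(3)[of k]] by simp
    then have "\<bar>u - s k\<bar> \<le> 1" by linarith
    then have "s k = 2 * u" using s2[of k] that(2) by auto
    moreover from this have "1 / t (Suc k) = - u" using t(2)[of k] that(1) by simp
    then have "t (Suc k) = - u" using that(2) t(3)[of k] by (auto simp: field_simps)
    ultimately show ?thesis by simp
  qed
  have unit: "e * (-1) ^ k \<in> {1, -1}" for k using assms(3) by (cases "even k") auto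
  have tk: "t k = of_int (e * (-1) ^ k)" for k
  proof (induction k)
    case (Suc k)
    then show ?case using step[OF Suc unit] by simp
  qed (use t(1) in simp)
  show ?thesis
  proof
    fix k
    show "s k = alternating_2 e k"
      using step[OF tk[of k] unit[of k]] by (simp only: alternating_2_def mult.assoc)
  qed
qed

text \<open>Prepending moves \<open>s 0\<close> out of the first position, the only one where 0 is
  allowed.\<close>

lemma infinite_EICF_case_nat:
  "infinite_EICF (case_nat b s) \<longleftrightarrow> even b \<and> infinite_EICF s \<and> s 0 \<noteq> 0"
  (is "?l \<longleftrightarrow> ?r")
proof
  assume l: ?l
  have "even (s n) \<and> s n \<noteq> 0" for n
    using l[unfolded infinite_EICF_def] by (metis nat.case(2) zero_less_Suc)
  moreover have "even b" using l[unfolded infinite_EICF_def] by (metis nat.case(1))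
  ultimately show ?r unfolding infinite_EICF_def by auto
next
  assume ?r
  then show ?l unfolding infinite_EICF_def by (auto split: nat.split) (metis neq0_conv)
qed

lemma real_value_case_nat:
  "real_value s t \<Longrightarrow> t \<noteq> 0 \<Longrightarrow> real_value (case_nat b s) (of_int b + 1 / t)"
  using real_value_Suc[of "case_nat b s" t] by simp

lemma eventually_alternates_2_case_nat:
  assumes "eventually_alternates_2 s"
  shows "eventually_alternates_2 (case_nat b s)"
proof -
  obtain N where "\<And>n. n \<ge> N \<Longrightarrow> s n \<in> {2, -2} \<and> s (Suc n) = - s n"
    using assms unfolding eventually_alternates_2_def by blast
  then have "\<forall>n\<ge>Suc N. case_nat b s n \<in> {2, -2} \<and> case_nat b s (Suc n) = - case_nat b s n"
    by (auto split: nat.split)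
  then show ?thesis unfolding eventually_alternates_2_def by blast
qed

text \<open>The difference \<open>a - s 0 = 1 / t\<close> is odd and at most 1 in absolute value,
  hence a sign \<open>e\<close>. The rest of the sequence has value \<open>e\<close> and nonzero
  first term, so it alternates.\<close>

lemma odd_integer_expansions:
  fixes a :: int
  assumes "odd a"
  shows "{s. infinite_EICF s \<and> real_value s (of_int a)}
    = {case_nat (a - 1) (alternating_2 1), case_nat (a + 1) (alternating_2 (-1))}"
    (is "?E = {?s, ?s'}")
proof (intro equalityI subsetI)
  fix s assume "s \<in> ?E"
  then have s: "infinite_EICF s" "real_value s (of_int a)" by auto
  obtain t where t: "real_value (\<lambda>n. s (Suc n)) t" "\<bar>t\<bar> \<ge> 1" "of_int a = s 0 + 1 / t"
    using real_value_tail[OF s] by blast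
  define e where "e = a - s 0"
  have e: "1 / t = of_int e" unfolding e_def using t(3) by simp
  then have "\<bar>real_of_int e\<bar> \<le> 1" using abs_inverse_le_1[OF t(2)] by simp
  moreover have "odd e" using s(1) assms unfolding e_def infinite_EICF_def by simp
  ultimately have e1: "e \<in> {1, -1}" by (cases "e = 0") auto
  then have "t = of_int e" using e t(2) by (auto simp: field_simps)
  then have "(\<lambda>n. s (Suc n)) = alternating_2 e"
    using t(1) e1 s(1) infinite_EICF_shift[OF s(1), of 1]
    by (intro eq_alternating_2) (auto simp: infinite_EICF_def)
  then have "s = case_nat (a - e) (alternating_2 e)"
    unfolding e_def by (auto split: nat.split simp: fun_eq_iff)
  then show "s \<in> {?s, ?s'}" using e1 by auto
next
  fix s assume "s \<in> {?s, ?s'}"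
  then obtain e where e: "e \<in> {1, -1}" "s = case_nat (a - e) (alternating_2 e)" by fastforce
  have "real_value s (of_int (a - e) + 1 / of_int e)"
    unfolding e(2) using e(1) by (intro real_value_case_nat real_value_alternating_2) auto
  moreover have "of_int (a - e) + 1 / of_int e = real_of_int a" using e(1) by auto
  moreover have "infinite_EICF s" unfolding e(2) infinite_EICF_case_nat
    using e(1) assms infinite_EICF_alternating_2 by (auto simp: alternating_2_def)
  ultimately show "s \<in> ?E" by simp
qed

text \<open>With \<open>\<bar>t\<bar> > 1\<close> the number \<open>x\<close> is strictly within 1
  of \<open>b\<close>, so every expansion of \<open>x\<close> starts with \<open>b\<close>.\<close>

lemma infinite_expansions_step:
  fixes x t :: real
  assumes "even b" "x = of_int b + 1 / t" "\<bar>t\<bar> > 1"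
  shows "{s. infinite_EICF s \<and> real_value s x}
    = case_nat b ` {s. infinite_EICF s \<and> real_value s t}" (is "?E = _ ` ?F")
proof (intro equalityI subsetI)
  fix s assume "s \<in> ?E"
  then have s: "infinite_EICF s" "real_value s x" by auto
  obtain u where u: "real_value (\<lambda>n. s (Suc n)) u" "\<bar>u\<bar> \<ge> 1" "x = s 0 + 1 / u"
    using real_value_tail[OF s] by blast
  have "\<bar>1 / t\<bar> < 1" using assms(3) by simp
  moreover have "x - b = 1 / t" "x - s 0 = 1 / u" using assms(2) u(3) by simp_all
  ultimately have "\<bar>x - b\<bar> < 1" "\<bar>x - s 0\<bar> \<le> 1"
    using abs_inverse_le_1[OF u(2)] by (simp_all only:)
  then have "s 0 = b"
    using even_ints_eq[of b "s 0" x] assms(1) s(1) unfolding infinite_EICF_def by simp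
  moreover from this have "u = t" using u(3) assms(2) by simp
  ultimately have "s = case_nat b (\<lambda>n. s (Suc n))" "(\<lambda>n. s (Suc n)) \<in> ?F"
    using u(1) infinite_EICF_shift[OF s(1), of 1] by (auto simp: fun_eq_iff split: nat.split)
  then show "s \<in> case_nat b ` ?F" by blast
next
  fix s assume "s \<in> case_nat b ` ?F"
  then obtain s' where s': "infinite_EICF s'" "real_value s' t" "s = case_nat b s'" by auto
  obtain u where u: "\<bar>u\<bar> \<ge> 1" "t = s' 0 + 1 / u"
    using real_value_tail[OF s'(1,2)] by metis
  \<comment> \<open>A zero first term would give \<open>t = 1 / u\<close>, of absolute value at most
    1.\<close>
  have "s' 0 \<noteq> 0" using u(2) abs_inverse_le_1[OF u(1)] assms(3) by auto
  then show "s \<in> ?E" unfolding s'(3) using s' assms real_value_case_nat[OF s'(2), of b]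
    by (auto simp: infinite_EICF_case_nat)
qed

text \<open>Descent on \<open>\<bar>b\<bar>\<close> with remainders for nearest even quotients.
  While \<open>b\<close> does not divide \<open>a\<close>, the first term is forced and the two
  expansions are inherited from \<open>b / r\<close>; at an odd integer they branch.\<close>

lemma odd_quotient_expansions:
  fixes a b :: int
  assumes "odd a" "odd b"
  shows "\<exists>s s'. s \<noteq> s' \<and> {s. infinite_EICF s \<and> real_value s (of_int a / of_int b)} = {s, s'} \<and>
    eventually_alternates_2 s \<and> eventually_alternates_2 s'"
  using assms
proof (induction "nat \<bar>b\<bar>" arbitrary: a b rule: less_induct)
  case less
  then have b0: "b \<noteq> 0" by auto
  show ?case
  proof (cases "b dvd a")
    case True
    then obtain m where m: "a = b * m" by blast
    have "odd m" using less.prems m by auto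
    moreover have "real_of_int a / of_int b = of_int m" using m b0 by simp
    moreover have "case_nat (m - 1) (alternating_2 1) \<noteq> case_nat (m + 1) (alternating_2 (-1))"
      by (auto dest: fun_cong[of _ _ 0])
    ultimately show ?thesis
      using odd_integer_expansions[of m] eventually_alternates_alternating_2
      by (metis eventually_alternates_2_case_nat insertCI)
  next
    case False
    obtain c :: int where c: "even c" "\<bar>of_int a / of_int b - c\<bar> \<le> (1::real)"
      using nearest_even_int by blast
    define r where "r = a - c * b"
    have r: "real_of_int a / of_int b - c = r / b" using b0 unfolding r_def by (simp add: field_simps)
    have "\<bar>r\<bar> \<le> \<bar>b\<bar>"
      using c(2) b0 unfolding r by (simp add: field_simps abs_divide flip: of_int_abs)
    moreover have "\<not> b dvd r" using False unfolding r_def by (simp add: dvd_diff_left_iff)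
    then have "\<bar>r\<bar> \<noteq> \<bar>b\<bar>" by (auto simp: abs_eq_iff)
    ultimately have lt: "\<bar>r\<bar> < \<bar>b\<bar>" by simp
    have "odd r" unfolding r_def using c(1) less.prems by simp
    then obtain s s' where IH: "s \<noteq> s'"
      "{s. infinite_EICF s \<and> real_value s (of_int b / of_int r)} = {s, s'}"
      "eventually_alternates_2 s" "eventually_alternates_2 s'"
      using less.hyps[of r b] lt less.prems by auto
    have r0: "r \<noteq> 0" using \<open>odd r\<close> by auto
    have "real_of_int \<bar>r\<bar> < of_int \<bar>b\<bar>" using lt by (simp only: of_int_less_iff)
    then have "\<bar>real_of_int b / of_int r\<bar> > 1" using r0 by (simp add: abs_divide)
    then have "{s. infinite_EICF s \<and> real_value s (of_int a / of_int b)} = {case_nat c s, case_nat c s'}"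
      using infinite_expansions_step[of c "of_int a / of_int b" "of_int b / of_int r"] c(1) r
      unfolding IH(2) by (simp add: algebra_simps)
    moreover have "case_nat c s \<noteq> case_nat c s'"
      using IH(1) by (metis ext nat.case(2))
    ultimately show ?thesis using IH(3,4) eventually_alternates_2_case_nat by blast
  qed
qed

section \<open>Finite EICFs\<close>

text \<open>Normalises the sign: the recursion for finite fractions produces denominators of either
  sign.\<close>

lemma infinity_rational_quotient:
  fixes a b :: int
  assumes "coprime a b" "even a \<noteq> even b" "b \<noteq> 0"
  shows "infinity_rational (Some (of_int a / of_int b))"
proof (cases "b > 0")
  case False
  then have "- b > 0" "coprime (- a) (- b)" "even (- a) \<noteq> even (- b)"
    "of_int a / of_int b = real_of_int (- a) / of_int (- b)" using assms by auto
  then show ?thesis unfolding infinity_rational_def by blast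
qed (use assms in \<open>auto simp: infinity_rational_def\<close>)

text \<open>Prepending \<open>b\<close> turns \<open>p / q\<close> into
  \<open>(q + b * p) / p\<close>, which keeps coprimality and, as \<open>b\<close> is even, the
  difference in parity.\<close>

lemma cfrac_eq_quotient:
  assumes "bs \<noteq> []" "finite_EICF bs"
  shows "\<exists>a b::int. coprime a b \<and> even a \<noteq> even b \<and> b \<noteq> 0 \<and> cfrac bs = of_int a / of_int b"
  using assms
proof (induction bs rule: cfrac.induct)
  case (2 b)
  then have "coprime b 1 \<and> even b \<noteq> even (1::int) \<and> (1::int) \<noteq> 0 \<and> cfrac [b] = of_int b / of_int 1"
    by (simp add: finite_EICF_def)
  then show ?case by blast
next
  case (3 b c bs)
  have "finite_EICF (c # bs)" using 3 by (auto simp: finite_EICF_def)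
  then obtain p q :: int where pq: "coprime p q" "even p \<noteq> even q" "q \<noteq> 0"
    "cfrac (c # bs) = of_int p / of_int q" using 3 by auto
  have "\<bar>cfrac (c # bs)\<bar> > 1" using 3 by (intro abs_cfrac_gt_1) (auto simp: finite_EICF_def)
  then have p: "p \<noteq> 0" using pq(4) by auto
  have "coprime (q + b * p) p" using pq(1) gcd_add_mult[of p b q]
    by (simp add: coprime_iff_gcd_eq_1 gcd.commute add.commute)
  moreover have "even (q + b * p) \<noteq> even p" using pq(2) 3 by (auto simp: finite_EICF_def)
  moreover have "cfrac (b # c # bs) = of_int (q + b * p) / of_int p"
    using pq(4) p by (simp add: field_simps)
  ultimately show ?case using p by blast
qed simp

lemma finite_EICF_infinity_rational:
  assumes "finite_EICF bs"
  shows "infinity_rational (finite_value bs)"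
proof (cases "bs = []")
  case False
  then show ?thesis unfolding finite_value_def
    using cfrac_eq_quotient[OF False assms] infinity_rational_quotient by auto
qed (simp add: finite_value_def infinity_rational_def)

text \<open>Finite tails exceed 1 strictly in absolute value, so the ambiguity at odd integers
  cannot arise.\<close>

lemma cfrac_first_term_dist:
  assumes "finite_EICF (b # bs)"
  shows "\<bar>cfrac (b # bs) - b\<bar> < 1"
proof (cases bs)
  case (Cons c cs)
  have "\<bar>cfrac bs\<bar> > 1" using assms Cons by (intro abs_cfrac_gt_1) (auto simp: finite_EICF_def)
  then have "\<bar>1 / cfrac bs\<bar> < 1" by simp
  then show ?thesis using Cons by simp
qed simp

lemma cfrac_inj:
  assumes "finite_EICF bs" "finite_EICF cs" "bs \<noteq> []" "cs \<noteq> []" "cfrac bs = cfrac cs"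
  shows "bs = cs"
  using assms
proof (induction bs arbitrary: cs)
  case (Cons b bs)
  obtain c cs' where cs: "cs = c # cs'" using Cons.prems(4) by (cases cs) auto
  have bc: "b = c"
    using even_ints_eq[of b c "cfrac (b # bs)"] cfrac_first_term_dist[OF Cons.prems(1)]
      cfrac_first_term_dist[of c cs'] Cons.prems unfolding cs by (auto simp: finite_EICF_def)
  have fin: "finite_EICF bs" "finite_EICF cs'"
    using Cons.prems(1,2) unfolding cs finite_EICF_def by (cases bs; cases cs'; simp)+
  have gt: "\<bar>cfrac bs\<bar> > 1" if "bs \<noteq> []"
    using that Cons.prems(1) by (intro abs_cfrac_gt_1) (auto simp: finite_EICF_def)
  have gt': "\<bar>cfrac cs'\<bar> > 1" if "cs' \<noteq> []"
    using that Cons.prems(2) unfolding cs by (intro abs_cfrac_gt_1) (auto simp: finite_EICF_def)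
  have expand: "cfrac (d # ds) = d + 1 / cfrac ds" if "ds \<noteq> []" for d ds
    using that by (cases ds) auto
  show ?case
  \<comment> \<open>If just one list ended here, the other would have a remainder with reciprocal 0,
    although its absolute value exceeds 1.\<close>
  proof (cases "bs = [] \<or> cs' = []")
    case True
    then show ?thesis using expand[of bs b] expand[of cs' c] gt gt' Cons.prems(5) bc
      unfolding cs by fastforce
  next
    case False
    then show ?thesis using Cons.IH[OF fin] expand Cons.prems(5) bc unfolding cs by auto
  qed
qed simp

text \<open>Euclidean algorithm with nearest even quotients: parity excludes
  \<open>\<bar>r\<bar> = \<bar>b\<bar>\<close>, so the remainders decrease strictly until one is
  0.\<close>

lemma quotient_finite_EICF:
  fixes a b :: int
  assumes "b \<noteq> 0" "odd (a + b)"
  shows "\<exists>bs. bs \<noteq> [] \<and> finite_EICF bs \<and> cfrac bs = of_int a / of_int b"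
  using assms
proof (induction "nat \<bar>b\<bar>" arbitrary: a b rule: less_induct)
  case less
  obtain c :: int where c: "even c" "\<bar>of_int a / of_int b - c\<bar> \<le> (1::real)"
    using nearest_even_int by blast
  define r where "r = a - c * b"
  have r: "real_of_int a / of_int b = c + r / b"
    using less.prems unfolding r_def by (simp add: field_simps)
  have "\<bar>r\<bar> \<le> \<bar>b\<bar>"
    using c(2) less.prems(1) unfolding r by (simp add: field_simps abs_divide flip: of_int_abs)
  moreover have odd: "odd (b + r)" unfolding r_def using c(1) less.prems by simp
  then have "\<bar>r\<bar> \<noteq> \<bar>b\<bar>" by (auto simp: abs_eq_iff)
  ultimately have lt: "\<bar>r\<bar> < \<bar>b\<bar>" by simp
  show ?case
  proof (cases "r = 0")
    case True
    then have "[c] \<noteq> [] \<and> finite_EICF [c] \<and> cfrac [c] = of_int a / of_int b"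
      using c(1) r by (simp add: finite_EICF_def)
    then show ?thesis by blast
  next
    case False
    then obtain bs where bs: "bs \<noteq> []" "finite_EICF bs" "cfrac bs = of_int b / of_int r"
      using less.hyps[of r b] lt odd less.prems(1) by auto
    obtain d ds where d: "bs = d # ds" using bs(1) by (cases bs) auto
    have "real_of_int \<bar>r\<bar> < of_int \<bar>b\<bar>" using lt by (simp only: of_int_less_iff)
    then have "\<bar>cfrac bs\<bar> > 1" using False unfolding bs(3) by (simp add: abs_divide)
    \<comment> \<open>\<open>cfrac bs\<close> is within 1 of \<open>d\<close> but exceeds 1 in
      absolute value; thus \<open>c\<close> may be prepended.\<close>
    then have "d \<noteq> 0" using cfrac_first_term_dist bs(2) unfolding d by fastforce
    then have "finite_EICF (c # bs)" using c(1) bs(2) unfolding d finite_EICF_def by auto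
    moreover have "cfrac (c # bs) = of_int a / of_int b" using bs(3) r unfolding d by simp
    ultimately show ?thesis by blast
  qed
qed

lemma finite_EICF_expansion_exists:
  assumes "infinity_rational x"
  shows "\<exists>bs. finite_EICF_expansion bs x"
proof (cases x)
  case None
  then have "finite_EICF_expansion [] x"
    by (simp add: finite_EICF_expansion_def finite_EICF_def finite_value_def)
  then show ?thesis by blast
next
  case (Some r)
  then obtain a b :: int where ab: "b > 0" "even a \<noteq> even b" "r = of_int a / of_int b"
    using assms by (auto simp: infinity_rational_def)
  then obtain bs where "bs \<noteq> []" "finite_EICF bs" "cfrac bs = r"
    using quotient_finite_EICF[of b a] by auto
  then show ?thesis using Some by (auto simp: finite_EICF_expansion_def finite_value_def)
qed

lemma finite_EICF_expansion_unique:
  assumes "finite_EICF_expansion bs x" "finite_EICF_expansion cs x"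
  shows "bs = cs"
  using assms cfrac_inj unfolding finite_EICF_expansion_def finite_value_def
  by (auto split: if_splits)

theorem theorem3p1:
  shows
    "(\<forall>bs. finite_EICF bs \<longrightarrow> infinity_rational (finite_value bs)) \<and>
     (\<forall>x. infinity_rational x \<longrightarrow> (\<exists>!bs. finite_EICF_expansion bs x)) \<and>
     (\<forall>s. infinite_EICF s \<longrightarrow>
        (\<exists>x. has_infinite_value s x) \<and>
        (\<forall>x. has_infinite_value s x \<longrightarrow> irrational x \<or> one_rational x)) \<and>
     (\<forall>x. irrational x \<longrightarrow> (\<exists>!s. infinite_EICF_expansion s x)) \<and>
     (\<forall>x. one_rational x \<longrightarrow>
        card {s. infinite_EICF_expansion s x} = 2 \<and>
        (\<forall>s. infinite_EICF_expansion s x \<longrightarrow> eventually_alternates_2 s))"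
proof (intro conjI allI impI)
  fix bs assume "finite_EICF bs"
  then show "infinity_rational (finite_value bs)" by (rule finite_EICF_infinity_rational)
next
  fix x assume "infinity_rational x"
  then show "\<exists>!bs. finite_EICF_expansion bs x"
    using finite_EICF_expansion_exists finite_EICF_expansion_unique by blast
next
  fix s assume "infinite_EICF s"
  then show "\<exists>x. has_infinite_value s x"
    using infinite_EICF_real_value has_infinite_value_iff by metis
next
  fix s x assume "infinite_EICF s" "has_infinite_value s x"
  then show "irrational x \<or> one_rational x"
    using has_infinite_value_iff[of s x] infinite_value_irrational_or_one_rational[of s] by auto
next
  fix x assume "irrational x"
  then obtain r where x: "x = Some r" and r: "r \<notin> \<rat>" unfolding irrational_def by blast
  obtain s where s: "infinite_EICF s" "real_value s r"
    using irrational_infinite_EICF_exists[OF r] by blast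
  show "\<exists>!s. infinite_EICF_expansion s x"
    unfolding x infinite_EICF_expansion_Some_iff
  proof (rule ex1I)
    show "infinite_EICF s \<and> real_value s r" using s by simp
    fix s' assume "infinite_EICF s' \<and> real_value s' r"
    then show "s' = s" using irrational_infinite_EICF_unique[OF _ _ s r] by simp
  qed
next
  fix x assume "one_rational x"
  then obtain a b :: int where ab: "odd a" "odd b" and x: "x = Some (of_int a / of_int b)"
    unfolding one_rational_def by blast
  obtain s s' where ss': "s \<noteq> s'" "{s. infinite_EICF_expansion s x} = {s, s'}"
    "eventually_alternates_2 s" "eventually_alternates_2 s'"
    using odd_quotient_expansions[OF ab] unfolding x infinite_EICF_expansion_Some_iff by blast
  then show "card {s. infinite_EICF_expansion s x} = 2" by simp
  fix u assume "infinite_EICF_expansion u x"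
  then have "u \<in> {s, s'}" unfolding ss'(2)[symmetric] by simp
  then show "eventually_alternates_2 u" using ss'(3,4) by auto
qed

end
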